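(* Let $\mathcal S\subset\mathcal M^{n\times n}$ be a class of nonsingular matrices closed with respect to (multiplicative) inversion, $\mathfrak D\subset\mathbb C$ a stability region, $\mathcal G\subset\mathcal M^{n\times n}$ a matrix class and $\circ$ a binary operation on $\mathcal M^{n\times n}$. Suppose that $\mathcal S$ commutes with $\mathcal G$ (i.e. $\mathbf S\mathbf G=\mathbf G\mathbf S$ for all $\mathbf S\in\mathcal S$, $\mathbf G\in\mathcal G$) and that one of the following holds: 1. $\circ$ is matrix multiplication; 2. matrix multiplication is distributive over $\circ$, in the sense that $\mathbf A(\mathbf B\circ\mathbf C)=(\mathbf A\mathbf B)\circ(\mathbf A\mathbf C)$ for all $\mathbf A,\mathbf B,\mathbf C\in\mathcal M^{n\times n}$. Then, for every $\mathbf S\in\mathcal S$ and $\mathbf A\in\mathcal M^{n\times n}$, the matrix $\mathbf S\mathbf A\mathbf S^{-1}$ is $(\mathfrak D,\mathcal G,\circ)$-stable if and only if $\mathbf A$ is $(\mathfrak D,\mathcal G,\circ)$-stable.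
   Context: $\mathcal M^{n\times n}$ is the set of real $n\times n$ matrices and $\sigma(\mathbf A)$ is the set of (complex) eigenvalues of $\mathbf A$. A stability region is a set $\mathfrak D\subset\mathbb C$ closed under complex conjugation. A matrix $\mathbf A$ is left (right) $(\mathfrak D,\mathcal G,\circ)$-stable if $\sigma(\mathbf G\circ\mathbf A)\subset\mathfrak D$ (respectively $\sigma(\mathbf A\circ\mathbf G)\subset\mathfrak D$) for every $\mathbf G\in\mathcal G$; it is $(\mathfrak D,\mathcal G,\circ)$-stable if it is both.
   Formalization: In case 2 distributivity is two-sided: (B∘C)A=(BA)∘(CA) is required as well as A(B∘C)=(AB)∘(AC). With the left law alone the claim fails: B∘C=CQ, Q=diag(1,2), 𝒮={P} with P the coordinate swap, 𝒢={I}, 𝔇={1,2}; PQP⁻¹ is stable, Q is not. *)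

theory Defs
  imports "HOL-Analysis.Analysis"
begin

text \<open>The set of complex eigenvalues of a real matrix, which is viewed as a complex
  matrix so that non-real eigenvalues are counted.\<close>

definition spectrum :: "real^'n^'n \<Rightarrow> complex set" where
  "spectrum A = {z. \<exists>v :: complex^'n. v \<noteq> 0 \<and> map_matrix complex_of_real A *v v = z *s v}"

definition stability_region :: "complex set \<Rightarrow> bool" where
  "stability_region D \<longleftrightarrow> (\<forall>z\<in>D. cnj z \<in> D)"

definition left_region_stable ::
  "complex set \<Rightarrow> (real^'n^'n) set \<Rightarrow> (real^'n^'n \<Rightarrow> real^'n^'n \<Rightarrow> real^'n^'n) \<Rightarrow> real^'n^'n \<Rightarrow> bool"
  where "left_region_stable D \<G> opn A \<longleftrightarrow> (\<forall>G\<in>\<G>. spectrum (opn G A) \<subseteq> D)"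

definition right_region_stable ::
  "complex set \<Rightarrow> (real^'n^'n) set \<Rightarrow> (real^'n^'n \<Rightarrow> real^'n^'n \<Rightarrow> real^'n^'n) \<Rightarrow> real^'n^'n \<Rightarrow> bool"
  where "right_region_stable D \<G> opn A \<longleftrightarrow> (\<forall>G\<in>\<G>. spectrum (opn A G) \<subseteq> D)"

definition region_stable ::
  "complex set \<Rightarrow> (real^'n^'n) set \<Rightarrow> (real^'n^'n \<Rightarrow> real^'n^'n \<Rightarrow> real^'n^'n) \<Rightarrow> real^'n^'n \<Rightarrow> bool"
  where "region_stable D \<G> opn A \<longleftrightarrow> left_region_stable D \<G> opn A \<and> right_region_stable D \<G> opn A"

text \<open>Distributivity is two-sided. The left law alone does not make stability invariant
  under conjugation: for 2 by 2 matrices and Q = diag(1,2), the operation sending (B, C)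
  to CQ satisfies it; let P be the matrix exchanging the coordinates, and take the class {P},
  the matrix class {I} and the region {1,2}. Then PQP is stable, since PQPQ = 2I and IQ = Q,
  but Q is not, since QQ = diag(1,4).\<close>

definition mult_distributive_over :: "(real^'n^'n \<Rightarrow> real^'n^'n \<Rightarrow> real^'n^'n) \<Rightarrow> bool" where
  "mult_distributive_over opn \<longleftrightarrow>
     (\<forall>A B C. A ** opn B C = opn (A ** B) (A ** C)) \<and>
     (\<forall>A B C. opn B C ** A = opn (B ** A) (C ** A))"

end

theory Submission
  imports Defs
begin

text \<open>Since \<open>S\<close> commutes with \<open>G\<close>, conjugation by \<open>S\<close> fixes \<open>G\<close>; it is an automorphism of the
  operation, so \<open>G \<circ> (S A S\<^sup>-\<^sup>1) = S (G \<circ> A) S\<^sup>-\<^sup>1\<close>, which has the spectrum of \<open>G \<circ> A\<close>.\<close>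

text \<open>\<open>matrix_inv\<close> picks some two-sided inverse by Hilbert choice, so
  invertibility yields both equations at once.\<close>

lemma
  fixes A :: "'a::semiring_1^'n^'m"
  assumes "invertible A"
  shows matrix_inv_right: "A ** matrix_inv A = mat 1"
    and matrix_inv_left: "matrix_inv A ** A = mat 1"
  using someI_ex[OF assms[unfolded invertible_def]] by (simp_all add: matrix_inv_def)

lemma map_matrix_of_real_mult:
  fixes A :: "real^'n^'m" and B :: "real^'p^'n"
  shows "map_matrix complex_of_real (A ** B) =
    map_matrix complex_of_real A ** map_matrix complex_of_real B"
  by (simp add: map_matrix_def matrix_matrix_mult_def vec_eq_iff)

lemma map_matrix_of_real_mat_1:
  "map_matrix complex_of_real (mat 1 :: real^'n^'n) = mat 1"
  by (simp add: map_matrix_def mat_def vec_eq_iff)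

text \<open>If \<open>v\<close> is an eigenvector of \<open>P ** A ** Q\<close>, then
  \<open>Q\<close> carries it to an eigenvector of \<open>A\<close> for the same eigenvalue. The
  hypotheses are symmetric in \<open>P\<close> and \<open>Q\<close>, so the lemma can be reused with
  the two exchanged.\<close>

lemma spectrum_conjugate_subset:
  fixes P Q A :: "real^'n^'n"
  assumes "P ** Q = mat 1" "Q ** P = mat 1"
  shows "spectrum (P ** A ** Q) \<subseteq> spectrum A"
proof
  fix z assume "z \<in> spectrum (P ** A ** Q)"
  then obtain v :: "complex^'n" where v: "v \<noteq> 0"
    and eig: "map_matrix complex_of_real (P ** A ** Q) *v v = z *s v"
    by (auto simp: spectrum_def)
  let ?P = "map_matrix complex_of_real P" and ?Q = "map_matrix complex_of_real Q"
    and ?A = "map_matrix complex_of_real A"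
  have PQ: "?P ** ?Q = mat 1" and QP: "?Q ** ?P = mat 1"
    using assms by (simp_all flip: map_matrix_of_real_mult add: map_matrix_of_real_mat_1)
  have "?P *v (?Q *v v) = v"
    by (simp add: matrix_vector_mul_assoc PQ)
  \<comment> \<open>Otherwise \<open>v\<close> would be the image of 0 under
    \<open>?P\<close>.\<close>
  then have "?Q *v v \<noteq> 0"
    using v by (metis matrix_vector_mult_0_right)
  moreover have "?A *v (?Q *v v) = z *s (?Q *v v)"
  proof -
    \<comment> \<open>Inserting \<open>?Q ** ?P\<close> in front completes the product
      \<open>P ** A ** Q\<close> acting on \<open>v\<close>, to which \<open>eig\<close>
      applies.\<close>
    have "?A *v (?Q *v v) = (?Q ** ?P) *v (?A *v (?Q *v v))"
      by (simp add: QP)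
    also have "\<dots> = ?Q *v (z *s v)"
      by (simp flip: eig add: map_matrix_of_real_mult matrix_vector_mul_assoc matrix_mul_assoc)
    finally show ?thesis
      by (simp add: vector_scalar_commute)
  qed
  ultimately show "z \<in> spectrum A"
    by (auto simp: spectrum_def)
qed

lemma spectrum_conjugate:
  fixes P A :: "real^'n^'n"
  assumes "invertible P"
  shows "spectrum (P ** A ** matrix_inv P) = spectrum A"
proof
  let ?Q = "matrix_inv P"
  have inv: "P ** ?Q = mat 1" "?Q ** P = mat 1"
    using assms by (simp_all add: matrix_inv_right matrix_inv_left)
  show "spectrum (P ** A ** ?Q) \<subseteq> spectrum A"
    by (rule spectrum_conjugate_subset[OF inv])
  \<comment> \<open>Conjugating back by the inverse recovers \<open>A\<close>, so the reverse
    inclusion is the same lemma with \<open>P\<close> and \<open>?Q\<close> exchanged.\<close>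
  have "?Q ** (P ** A ** ?Q) ** P = (?Q ** P) ** A ** (?Q ** P)"
    by (simp only: matrix_mul_assoc)
  then show "spectrum A \<subseteq> spectrum (P ** A ** ?Q)"
    using spectrum_conjugate_subset[OF inv(2,1), of "P ** A ** ?Q"] by (simp add: inv)
qed

text \<open>For multiplication, the inner factor \<open>matrix_inv S ** S\<close> cancels. In the
  distributive case, the left law moves \<open>S\<close> inside and the right law moves
  \<open>matrix_inv S\<close> inside.\<close>

lemma conjugate_opn:
  fixes S :: "real^'n^'n"
  assumes "invertible S"
    and "opn = (\<lambda>A B. A ** B) \<or> mult_distributive_over opn"
  shows "S ** opn B C ** matrix_inv S = opn (S ** B ** matrix_inv S) (S ** C ** matrix_inv S)"
  using assms(2)
proof
  assume opn: "opn = (\<lambda>A B. A ** B)"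
  have "S ** B ** matrix_inv S ** (S ** C ** matrix_inv S)
      = S ** B ** (matrix_inv S ** S) ** C ** matrix_inv S"
    by (simp only: matrix_mul_assoc)
  then show ?thesis
    by (simp add: opn matrix_inv_left[OF assms(1)] matrix_mul_assoc)
next
  assume "mult_distributive_over opn"
  then show ?thesis
    by (simp add: mult_distributive_over_def)
qed

theorem theorem83:
  fixes \<S> \<G> :: "(real^'n^'n) set"
    and D :: "complex set"
    and opn :: "real^'n^'n \<Rightarrow> real^'n^'n \<Rightarrow> real^'n^'n"
  assumes "\<forall>S\<in>\<S>. invertible S"
    and "\<forall>S\<in>\<S>. matrix_inv S \<in> \<S>"
    and "stability_region D"
    and "\<forall>S\<in>\<S>. \<forall>G\<in>\<G>. S ** G = G ** S"
    and "opn = (\<lambda>A B. A ** B) \<or> mult_distributive_over opn"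
  shows "\<forall>S\<in>\<S>. \<forall>A. region_stable D \<G> opn (S ** A ** matrix_inv S) \<longleftrightarrow> region_stable D \<G> opn A"
proof (intro ballI allI)
  fix S A assume S: "S \<in> \<S>"
  have inv: "invertible S"
    using assms(1) S by blast
  \<comment> \<open>The spectra agree for each single \<open>G\<close>, which settles both
    directions of the equivalence together.\<close>
  have "spectrum (opn G (S ** A ** matrix_inv S)) = spectrum (opn G A)"
    and "spectrum (opn (S ** A ** matrix_inv S) G) = spectrum (opn A G)" if "G \<in> \<G>" for G
  proof -
    have "S ** G ** matrix_inv S = G ** (S ** matrix_inv S)"
      using assms(4) S that by (simp add: matrix_mul_assoc)
    then have G: "S ** G ** matrix_inv S = G"
      by (simp add: matrix_inv_right[OF inv])
    show "spectrum (opn G (S ** A ** matrix_inv S)) = spectrum (opn G A)"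
      using conjugate_opn[OF inv assms(5), of G A] spectrum_conjugate[OF inv, of "opn G A"]
      by (simp add: G)
    show "spectrum (opn (S ** A ** matrix_inv S) G) = spectrum (opn A G)"
      using conjugate_opn[OF inv assms(5), of A G] spectrum_conjugate[OF inv, of "opn A G"]
      by (simp add: G)
  qed
  then show "region_stable D \<G> opn (S ** A ** matrix_inv S) \<longleftrightarrow> region_stable D \<G> opn A"
    by (simp add: region_stable_def left_region_stable_def right_region_stable_def)
qed

end
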